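(* Let $n\ge 2$ and let $\psi:M^{n}\rightarrow \mathbb{R}^{m+1}$ be a smooth immersion of a compact connected $n$-dimensional manifold $M^n$ in Euclidean space $\mathbb{R}^{m+1}$, $n\le m$. Then there always exists $v\in \mathbb{R}^{m+1}\setminus\{0\}$ such that $b(\psi,v) \leq B(\psi)$, and there always exists $v\in \mathbb{S}^{m}$ such that $\tilde{b}(\psi,v) \leq B(\psi)$.
   Context: $M^n$ carries the metric induced by $\psi$ from the Euclidean metric $\langle\,,\rangle$; $dV$ is its canonical measure and $\mathrm{vol}(M^n)$ its volume. $\mathbf{H}=\frac1n\mathrm{trace}\,\mathrm{II}$ is the mean curvature vector field, with $\mathrm{II}$ the second fundamental form of $\psi$. For $v\in\mathbb{R}^{m+1}$, $v^{\top}$ is the vector field on $M^n$ which at each $p$ is the orthogonal projection of $v$ onto $T_pM^n$. $\mathbb{S}^m$ is the unit sphere of $\mathbb{R}^{m+1}$. Define $$B(\psi)=n\,\frac{\int_{M^n}\|\mathbf{H}\|^2\,dV}{\mathrm{vol}(M^n)},\qquad b(\psi,v)=n\,\frac{\int_{M^n}\big(\|\mathbf{H}\|^2+\langle \mathbf{H}, v \rangle^{2} \big) dV}{\mathrm{vol}(M^{n}) +\frac{1}{n} \int_{M^n}\| v^{\top}\|^2\, dV}\quad (v\in\mathbb{R}^{m+1}),$$ $$\tilde b(\psi,v)=n\,\frac{\int_{M^n}\big(\|\mathbf{H}\|^2-\langle \mathbf{H}, v \rangle^{2} \big) dV}{\mathrm{vol}(M^{n}) -\frac{1}{n} \int_{M^n}\|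 v^{\top}\|^2\, dV}\quad (v\in\mathbb{S}^{m}),$$ where the last denominator is positive for every $v\in\mathbb{S}^m$. *)

theory Defs
  imports "HOL-Analysis.Analysis"
begin

fun Ck_on :: "nat \<Rightarrow> 'e::euclidean_space set \<Rightarrow> ('e \<Rightarrow> 'f::euclidean_space) \<Rightarrow> bool" where
  "Ck_on 0 S f \<longleftrightarrow> continuous_on S f"
| "Ck_on (Suc k) S f \<longleftrightarrow> (\<forall>x\<in>S. f differentiable (at x)) \<and>
     (\<forall>v. Ck_on k S (\<lambda>x. frechet_derivative f (at x) v))"

text \<open>Intended for open \<open>S\<close> only: differentiability is taken in full neighbourhoods.\<close>

definition smooth_on :: "'e::euclidean_space set \<Rightarrow> ('e \<Rightarrow> 'f::euclidean_space) \<Rightarrow> bool" where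
  "smooth_on S f \<longleftrightarrow> (\<forall>k. Ck_on k S f)"

text \<open>
  The manifold is the whole of a Hausdorff, second countable type, with a smooth
  structure given by a (not necessarily maximal) atlas. A chart is a pair of its domain and
  a coordinate map, whose values outside the domain are irrelevant. The dimension is the
  number of elements of the index type \<open>'n\<close>.
\<close>

type_synonym ('a, 'n) chart = "'a set \<times> ('a \<Rightarrow> real ^ 'n)"

definition chart_inv :: "('a, 'n) chart \<Rightarrow> real ^ 'n \<Rightarrow> 'a" where
  "chart_inv c = inv_into (fst c) (snd c)"

definition is_chart :: "('a::topological_space, 'n::finite) chart \<Rightarrow> bool" where
  "is_chart c \<longleftrightarrow> open (fst c) \<and> open (snd c ` fst c) \<and>
     homeomorphism (fst c) (snd c ` fst c) (snd c) (chart_inv c)"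

definition smooth_atlas ::
    "('a::{t2_space,second_countable_topology}, 'n::finite) chart set \<Rightarrow> bool" where
  "smooth_atlas \<A> \<longleftrightarrow> (\<forall>c\<in>\<A>. is_chart c) \<and> (\<Union>c\<in>\<A>. fst c) = UNIV \<and>
     (\<forall>c\<in>\<A>. \<forall>d\<in>\<A>. smooth_on (snd c ` (fst c \<inter> fst d)) (snd d \<circ> chart_inv c))"

definition smooth_immersion ::
    "('a, 'n::finite) chart set \<Rightarrow> ('a \<Rightarrow> real ^ 'k::finite) \<Rightarrow> bool" where
  "smooth_immersion \<A> \<psi> \<longleftrightarrow> (\<forall>c\<in>\<A>. smooth_on (snd c ` fst c) (\<psi> \<circ> chart_inv c) \<and>
     (\<forall>x\<in>snd c ` fst c. inj (frechet_derivative (\<psi> \<circ> chart_inv c) (at x))))"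

text \<open>
  The pointwise objects below are computed in an arbitrary chart around \<open>p\<close>. For a smooth
  immersion of a smooth atlas they do not depend on this choice.
\<close>

definition chart_at :: "('a, 'n) chart set \<Rightarrow> 'a \<Rightarrow> ('a, 'n) chart" where
  "chart_at \<A> p = (SOME c. c \<in> \<A> \<and> p \<in> fst c)"

text \<open>\<open>T\<^sub>p M\<close> is identified with its image under the differential of \<open>\<psi>\<close>.\<close>

definition tangent_space ::
    "('a, 'n::finite) chart set \<Rightarrow> ('a \<Rightarrow> real ^ 'k::finite) \<Rightarrow> 'a \<Rightarrow> (real ^ 'k) set" where
  "tangent_space \<A> \<psi> p =
     (let c = chart_at \<A> p in range (frechet_derivative (\<psi> \<circ> chart_inv c) (at (snd c p))))"

definition orth_proj :: "'b::euclidean_space set \<Rightarrow> 'b \<Rightarrow> 'b" where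
  "orth_proj T v = (THE w. w \<in> T \<and> (\<forall>u\<in>T. (v - w) \<bullet> u = 0))"

definition tangential_part ::
    "('a, 'n::finite) chart set \<Rightarrow> ('a \<Rightarrow> real ^ 'k::finite) \<Rightarrow> real ^ 'k \<Rightarrow> 'a \<Rightarrow> real ^ 'k" where
  "tangential_part \<A> \<psi> v p = orth_proj (tangent_space \<A> \<psi> p) v"

text \<open>
  The second fundamental form is the normal component of the Euclidean derivative in
  direction \<open>u\<close> of a local tangent vector field extending \<open>w\<close>. The extension used here has
  constant coordinates in the chart: with \<open>X = \<psi> \<circ> chart_inv c\<close> it is \<open>y \<mapsto> dX\<^sub>y(b)\<close>, where
  \<open>b\<close> is the vector with \<open>dX(b) = w\<close> at \<open>p\<close>.
\<close>

definition second_fundamental_form ::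
    "('a, 'n::finite) chart set \<Rightarrow> ('a \<Rightarrow> real ^ 'k::finite) \<Rightarrow> 'a \<Rightarrow>
      real ^ 'k \<Rightarrow> real ^ 'k \<Rightarrow> real ^ 'k" where
  "second_fundamental_form \<A> \<psi> p u w =
     (let c = chart_at \<A> p; x = snd c p; X = \<psi> \<circ> chart_inv c;
          dX = frechet_derivative X (at x);
          a = inv dX u; b = inv dX w;
          D = frechet_derivative (\<lambda>y. frechet_derivative X (at y) b) (at x) a
      in D - orth_proj (tangent_space \<A> \<psi> p) D)"

definition is_orthonormal_basis :: "'b::euclidean_space set \<Rightarrow> 'b set \<Rightarrow> bool" where
  "is_orthonormal_basis T E \<longleftrightarrow>
     E \<subseteq> T \<and> pairwise orthogonal E \<and> (\<forall>e\<in>E. norm e = 1) \<and> span E = T"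

text \<open>The trace of a bilinear map on \<open>T\<close> is the same for every orthonormal basis.\<close>

definition trace_on ::
    "'b::euclidean_space set \<Rightarrow> ('b \<Rightarrow> 'b \<Rightarrow> 'c::real_vector) \<Rightarrow> 'c" where
  "trace_on T \<beta> = (\<Sum>e\<in>(SOME E. is_orthonormal_basis T E). \<beta> e e)"

definition mean_curvature ::
    "('a, 'n::finite) chart set \<Rightarrow> ('a \<Rightarrow> real ^ 'k::finite) \<Rightarrow> 'a \<Rightarrow> real ^ 'k" where
  "mean_curvature \<A> \<psi> p =
     (1 / real CARD('n)) *\<^sub>R trace_on (tangent_space \<A> \<psi> p) (second_fundamental_form \<A> \<psi> p)"

definition induced_metric ::
    "('a, 'n::finite) chart \<Rightarrow> ('a \<Rightarrow> real ^ 'k::finite) \<Rightarrow> real ^ 'n \<Rightarrow> real ^ 'n ^ 'n" where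
  "induced_metric c \<psi> x =
     (let dX = frechet_derivative (\<psi> \<circ> chart_inv c) (at x)
      in \<chi> i j. dX (axis i 1) \<bullet> dX (axis j 1))"

text \<open>
  The canonical measure is the unique Borel measure whose density in every chart of the
  atlas, with respect to Lebesgue measure, is the square root of the Gram determinant.
\<close>

definition canonical_measure ::
    "('a::topological_space, 'n::finite) chart set \<Rightarrow> ('a \<Rightarrow> real ^ 'k::finite) \<Rightarrow> 'a measure" where
  "canonical_measure \<A> \<psi> = (THE \<mu>. sets \<mu> = sets borel \<and>
     (\<forall>c\<in>\<A>. \<forall>A\<in>sets borel. A \<subseteq> fst c \<longrightarrow>
        emeasure \<mu> A =
          (\<integral>\<^sup>+x\<in>snd c ` A. ennreal (sqrt (det (induced_metric c \<psi> x))) \<partial>lborel)))"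

definition volume ::
    "('a::topological_space, 'n::finite) chart set \<Rightarrow> ('a \<Rightarrow> real ^ 'k::finite) \<Rightarrow> real" where
  "volume \<A> \<psi> = measure (canonical_measure \<A> \<psi>) UNIV"

definition B_quot ::
    "('a::topological_space, 'n::finite) chart set \<Rightarrow> ('a \<Rightarrow> real ^ 'k::finite) \<Rightarrow> real" where
  "B_quot \<A> \<psi> = real CARD('n) *
     ((\<integral>p. (norm (mean_curvature \<A> \<psi> p))\<^sup>2 \<partial>canonical_measure \<A> \<psi>) / volume \<A> \<psi>)"

definition b_quot ::
    "('a::topological_space, 'n::finite) chart set \<Rightarrow> ('a \<Rightarrow> real ^ 'k::finite) \<Rightarrow>
      real ^ 'k \<Rightarrow> real" where
  "b_quot \<A> \<psi> v = real CARD('n) *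
     ((\<integral>p. (norm (mean_curvature \<A> \<psi> p))\<^sup>2 + (mean_curvature \<A> \<psi> p \<bullet> v)\<^sup>2
         \<partial>canonical_measure \<A> \<psi>) /
      (volume \<A> \<psi> + 1 / real CARD('n) *
         (\<integral>p. (norm (tangential_part \<A> \<psi> v p))\<^sup>2 \<partial>canonical_measure \<A> \<psi>)))"

definition b_tilde_quot ::
    "('a::topological_space, 'n::finite) chart set \<Rightarrow> ('a \<Rightarrow> real ^ 'k::finite) \<Rightarrow>
      real ^ 'k \<Rightarrow> real" where
  "b_tilde_quot \<A> \<psi> v = real CARD('n) *
     ((\<integral>p. (norm (mean_curvature \<A> \<psi> p))\<^sup>2 - (mean_curvature \<A> \<psi> p \<bullet> v)\<^sup>2
         \<partial>canonical_measure \<A> \<psi>) /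
      (volume \<A> \<psi> - 1 / real CARD('n) *
         (\<integral>p. (norm (tangential_part \<A> \<psi> v p))\<^sup>2 \<partial>canonical_measure \<A> \<psi>)))"

end

theory Submission
  imports Defs
begin

text \<open>
  Both claims follow by averaging over an orthonormal basis \<open>e\<^sub>0, \<dots>, e\<^sub>m\<close> of the ambient space. As
  \<open>\<Sum>\<^sub>i \<langle>H, e\<^sub>i\<rangle>\<^sup>2 = \<parallel>H\<parallel>\<^sup>2\<close> and \<open>\<Sum>\<^sub>i \<parallel>e\<^sub>i\<^sup>\<top>\<parallel>\<^sup>2 = n\<close>, the numerators of \<open>b(\<psi>, e\<^sub>i)\<close> add up to \<open>m + 2\<close> times that of
  \<open>B(\<psi>)\<close>, and so do the denominators; for the second quotient the factor is \<open>m\<close>. Hence some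
  \<open>e\<^sub>i\<close> satisfies the inequality. The canonical measure exists because, by the change of variables
  formula, the densities in different charts agree on overlaps; so it is a Borel measure, for which
  the lower semicontinuous functions \<open>\<parallel>v\<^sup>\<top>\<parallel>\<^sup>2\<close> are measurable.
\<close>

section \<open>Change of variables\<close>

text \<open>The library's change of variables theorem needs a wellordered index type. For an arbitrary finite
  index type it is transported along a relabelling of coordinates by \<open>ranked\<close>.\<close>

typedef ('n::finite) ranked = "{..<CARD('n)}" morphisms rank of_rank
  by (auto intro!: exI[of _ 0])

instantiation ranked :: (finite) wellorder
begin

definition "x \<le> y \<longleftrightarrow> rank x \<le> rank y"
definition "x < y \<longleftrightarrow> rank x < rank y"

instance
proof
  fix P :: "'a ranked \<Rightarrow> bool" and a
  assume step: "\<And>x. (\<And>y. y < x \<Longrightarrow> P y) \<Longrightarrow> P x"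
  show "P a"
    by (induction "rank a" arbitrary: a rule: less_induct) (auto intro: step simp: less_ranked_def)
qed (auto simp: less_eq_ranked_def less_ranked_def rank_inject)

end

instance ranked :: (finite) finite
proof
  have "(UNIV :: 'a ranked set) = of_rank ` {..<CARD('a)}"
    using type_definition.Abs_image[OF type_definition_ranked] by auto
  then show "finite (UNIV :: 'a ranked set)"
    by (metis finite_imageI finite_lessThan)
qed

lemma ranked_bij: "\<exists>\<sigma> :: 'n::finite ranked \<Rightarrow> 'n. bij \<sigma>"
proof (rule finite_same_card_bij)
  show "CARD('n ranked) = CARD('n)"
    using type_definition.card[OF type_definition_ranked[where 'n='n]] by simp
qed auto

text \<open>Conjugation by \<sigma>, which is \<open>map_permutation UNIV \<sigma>\<close>, is a
  sign-preserving bijection between the permutations of the two index types. It matches the terms of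
  the two Leibniz sums.\<close>

lemma det_reindex:
  fixes A :: "real^'n::finite^'n" and \<sigma> :: "'m::finite \<Rightarrow> 'n"
  assumes "bij \<sigma>"
  shows "det (\<chi> i j. A $ \<sigma> i $ \<sigma> j) = det A"
proof -
  let ?m = "map_permutation UNIV \<sigma>" and ?m' = "map_permutation UNIV (inv \<sigma>)"
  have inj: "inj \<sigma>" and surj: "surj \<sigma>" and bij': "bij (inv \<sigma>)"
    using assms by (auto simp: bij_is_inj bij_is_surj bij_imp_bij_inv)
  have "det A = (\<Sum>p | p permutes (UNIV::'m set). of_int (sign (?m p)) * (\<Prod>i\<in>UNIV. A $ i $ ?m p i))"
    unfolding det_def
  proof (rule sum.reindex_bij_witness[where i = ?m and j = ?m'])
    fix p :: "'n \<Rightarrow> 'n" assume "p \<in> {p. p permutes UNIV}"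
    then have p: "p permutes UNIV" by simp
    show "?m (?m' p) = p"
      by (rule map_permutation_compose_inv[where A = UNIV and B = UNIV])
         (use p bij' surj in \<open>auto simp: surj_f_inv_f\<close>)
    then show "of_int (sign (?m (?m' p))) * (\<Prod>i\<in>UNIV. A $ i $ ?m (?m' p) i) =
       of_int (sign p) * (\<Prod>i\<in>UNIV. A $ i $ p i)" by simp
    show "?m' p \<in> {p. p permutes UNIV}"
      using map_permutation_permutes[of "inv \<sigma>" UNIV UNIV p] bij' p by simp
  next
    fix p :: "'m \<Rightarrow> 'm" assume "p \<in> {p. p permutes UNIV}"
    then have p: "p permutes UNIV" by simp
    show "?m' (?m p) = p"
      by (rule map_permutation_compose_inv[where A = UNIV and B = UNIV])
         (use p assms inj in \<open>auto\<close>)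
    show "?m p \<in> {p. p permutes UNIV}"
      using map_permutation_permutes[of \<sigma> UNIV UNIV p] assms p by simp
  qed
  also have "\<dots> = det (\<chi> i j. A $ \<sigma> i $ \<sigma> j)"
    unfolding det_def
  proof (rule sum.cong[OF refl])
    fix p :: "'m \<Rightarrow> 'm" assume "p \<in> {p. p permutes UNIV}"
    then have p: "p permutes UNIV" by simp
    have "(\<Prod>i\<in>UNIV. A $ i $ ?m p i) = (\<Prod>i\<in>UNIV. A $ \<sigma> i $ ?m p (\<sigma> i))"
      using prod.reindex_bij_betw[of \<sigma> UNIV UNIV "\<lambda>i. A $ i $ ?m p i"] assms by simp
    also have "\<dots> = (\<Prod>i\<in>UNIV. A $ \<sigma> i $ \<sigma> (p i))"
      by (simp add: map_permutation_apply inj)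
    finally show "of_int (sign (?m p)) * (\<Prod>i\<in>UNIV. A $ i $ ?m p i) =
      of_int (sign p) * (\<Prod>i\<in>UNIV. (\<chi> i j. A $ \<sigma> i $ \<sigma> j) $ i $ p i)"
      by (simp add: sign_map_permutation inj p)
  qed
  finally show ?thesis ..
qed

text \<open>For a nonnegative Borel function both sides say that its integral is finite; passing
  from \<open>lborel\<close> to its completion does not affect this. The equivalence carries results
  about absolute integrability over to integrals that may be infinite.\<close>

lemma absolutely_integrable_on_iff_nn_integral:
  fixes F :: "'a::euclidean_space \<Rightarrow> real"
  assumes A: "A \<in> sets borel" and meas: "set_borel_measurable borel A F"
    and nonneg: "\<And>x. x \<in> A \<Longrightarrow> 0 \<le> F x"
  shows "F absolutely_integrable_on A \<longleftrightarrow> (\<integral>\<^sup>+x\<in>A. ennreal (F x) \<partial>lborel) < \<infinity>"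
proof -
  have m: "(\<lambda>x. indicator A x *\<^sub>R F x) \<in> borel_measurable lborel"
    using meas by (simp add: set_borel_measurable_def)
  have "F absolutely_integrable_on A \<longleftrightarrow> integrable lborel (\<lambda>x. indicator A x *\<^sub>R F x)"
    unfolding set_integrable_def by (rule integrable_completion[OF m])
  also have "\<dots> \<longleftrightarrow> (\<integral>\<^sup>+x. ennreal (norm (indicator A x *\<^sub>R F x)) \<partial>lborel) < \<infinity>"
    using m by (simp add: integrable_iff_bounded)
  also have "(\<integral>\<^sup>+x. ennreal (norm (indicator A x *\<^sub>R F x)) \<partial>lborel) = (\<integral>\<^sup>+x\<in>A. ennreal (F x) \<partial>lborel)"
    by (rule nn_integral_cong) (auto simp: indicator_def nonneg)
  finally show ?thesis .
qed

text \<open>The change of variables theorem for absolutely integrable functions gives equal values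
  when \<open>f\<close> is integrable. It also says that the two integrands are integrable together,
  so otherwise both nonnegative integrals are infinite.\<close>

lemma nn_integral_change_of_variables_wellorder:
  fixes f :: "real^'n::{finite,wellorder} \<Rightarrow> real" and g :: "real^'n::_ \<Rightarrow> real^'n::_"
  assumes S: "S \<in> sets borel" and gS: "g ` S \<in> sets borel"
    and der: "\<And>x. x \<in> S \<Longrightarrow> (g has_derivative g' x) (at x within S)"
    and inj: "inj_on g S"
    and nonneg: "\<And>y. y \<in> g ` S \<Longrightarrow> 0 \<le> f y"
    and f: "set_borel_measurable borel (g ` S) f"
    and fg: "set_borel_measurable borel S (\<lambda>x. \<bar>det (matrix (g' x))\<bar> * f (g x))"
  shows "(\<integral>\<^sup>+y\<in>g ` S. ennreal (f y) \<partial>lborel) =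
         (\<integral>\<^sup>+x\<in>S. ennreal (\<bar>det (matrix (g' x))\<bar> * f (g x)) \<partial>lborel)"
proof -
  let ?h = "\<lambda>x. \<bar>det (matrix (g' x))\<bar> * f (g x)"
  have cov: "?h absolutely_integrable_on S \<and> integral S ?h = b \<longleftrightarrow>
      f absolutely_integrable_on (g ` S) \<and> integral (g ` S) f = b" for b
  proof -
    \<comment> \<open>The theorem applied here concerns vector-valued functions, so real functions
      are viewed as maps into \<open>real^1\<close>.\<close>
    have "(\<lambda>x. \<bar>det (matrix (g' x))\<bar> *\<^sub>R (vec (f (g x)) :: real^1)) absolutely_integrable_on S \<and>
        integral S (\<lambda>x. \<bar>det (matrix (g' x))\<bar> *\<^sub>R (vec (f (g x)) :: real^1)) = vec b \<longleftrightarrow>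
      (\<lambda>y. vec (f y) :: real^1) absolutely_integrable_on (g ` S) \<and>
        integral (g ` S) (\<lambda>y. vec (f y) :: real^1) = vec b"
      by (rule has_absolute_integral_change_of_variables[OF _ der inj]) (use S in auto)
    then show ?thesis
      by (simp add: absolutely_integrable_on_1_iff integral_on_1_eq)
  qed
  have nonneg': "\<And>x. x \<in> S \<Longrightarrow> 0 \<le> ?h x" using nonneg by auto
  note f_iff = absolutely_integrable_on_iff_nn_integral[OF gS f nonneg]
  note h_iff = absolutely_integrable_on_iff_nn_integral[OF S fg nonneg']
  show ?thesis
  proof (cases "f absolutely_integrable_on (g ` S)")
    case True
    then have h: "?h absolutely_integrable_on S" "integral S ?h = integral (g ` S) f"
      using cov by blast+
    show ?thesis
      using set_nn_integral_lborel_eq_integral[OF f nonneg] f_iff True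
        set_nn_integral_lborel_eq_integral[OF fg nonneg'] h_iff h by simp
  next
    case False
    \<comment> \<open>With \<open>b\<close> in \<open>cov\<close> chosen as the integral of
      \<open>?h\<close>, integrability of \<open>?h\<close> would force that of
      \<open>f\<close>.\<close>
    then have "\<not> ?h absolutely_integrable_on S" using cov by blast
    then show ?thesis
      using False f_iff h_iff by (simp add: less_top[symmetric])
  qed
qed

section \<open>Relabelling of coordinates\<close>

definition relabel :: "('m \<Rightarrow> 'n) \<Rightarrow> real^'n \<Rightarrow> real^'m" where
  "relabel \<sigma> x = (\<chi> i. x $ \<sigma> i)"

lemma relabel_nth [simp]: "relabel \<sigma> x $ i = x $ \<sigma> i"
  by (simp add: relabel_def)

lemma linear_relabel: "linear (relabel \<sigma> :: real^'n::finite \<Rightarrow> real^'m::finite)"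
  by (auto intro!: linearI simp: vec_eq_iff)

lemma bounded_linear_relabel: "bounded_linear (relabel \<sigma> :: real^'n::finite \<Rightarrow> real^'m::finite)"
  using linear_relabel linear_conv_bounded_linear by blast

lemma measurable_relabel [measurable]:
  "(relabel \<sigma> :: real^'n::finite \<Rightarrow> real^'m::finite) \<in> borel_measurable borel"
  by (intro borel_measurable_continuous_onI linear_continuous_on bounded_linear_relabel)

lemma relabel_inv:
  assumes "bij \<sigma>"
  shows "relabel (inv \<sigma>) (relabel \<sigma> x) = x" "relabel \<sigma> (relabel (inv \<sigma>) y) = y"
  using assms by (auto simp: vec_eq_iff bij_def surj_f_inv_f)

text \<open>The preimage of a box is a box with the same side lengths in another order, and Lebesgue
  measure is determined by its values on boxes.\<close>

lemma lborel_relabel: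
  fixes \<sigma> :: "'m::finite \<Rightarrow> 'n::finite"
  assumes "bij \<sigma>"
  shows "distr lborel borel (relabel \<sigma>) = lborel"
proof (rule lborel_eqI[symmetric])
  fix l u :: "real^'m"
  assume le: "\<And>b. b \<in> Basis \<Longrightarrow> l \<bullet> b \<le> u \<bullet> b"
  have le': "l $ i \<le> u $ i" for i
    using le[of "axis i 1"] by (simp add: inner_axis axis_in_Basis_iff)
  let ?Q = "relabel (inv \<sigma>)"
  have vim: "relabel \<sigma> -` box l u = box (?Q l) (?Q u)"
  proof -
    have "(\<forall>i. l $ i < x $ \<sigma> i \<and> x $ \<sigma> i < u $ i) \<longleftrightarrow> (\<forall>j. l $ inv \<sigma> j < x $ j \<and> x $ j < u $ inv \<sigma> j)" for x :: "real^'n"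
      using assms by (metis bij_inv_eq_iff)
    then show ?thesis by (auto simp: mem_box_cart)
  qed
  have "emeasure (distr lborel borel (relabel \<sigma>)) (box l u) = emeasure lborel (box (?Q l) (?Q u))"
    by (subst emeasure_distr) (auto simp: vim)
  also have "\<dots> = ennreal (\<Prod>b\<in>Basis. (?Q u - ?Q l) \<bullet> b)"
    by (rule emeasure_lborel_box) (auto simp: Basis_vec_def inner_axis le')
  also have "(\<Prod>b\<in>Basis. (?Q u - ?Q l) \<bullet> b) = (\<Prod>j\<in>UNIV. u $ inv \<sigma> j - l $ inv \<sigma> j)"
    by (subst Basis_vec_def)
      (simp add: image_image UNION_singleton_eq_range prod.reindex inj_def axis_eq_axis inner_axis)
  also have "\<dots> = (\<Prod>i\<in>UNIV. u $ i - l $ i)"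
    using prod.reindex_bij_betw[of "inv \<sigma>" UNIV UNIV "\<lambda>i. u $ i - l $ i"] assms
    by (simp add: bij_imp_bij_inv)
  also have "\<dots> = (\<Prod>b\<in>Basis. (u - l) \<bullet> b)"
    by (subst Basis_vec_def)
      (simp add: image_image UNION_singleton_eq_range prod.reindex inj_def axis_eq_axis inner_axis)
  finally show "emeasure (distr lborel borel (relabel \<sigma>)) (box l u) = ennreal (\<Prod>b\<in>Basis. (u - l) \<bullet> b)" .
qed simp

text \<open>The map \<open>g\<close> is conjugated by the mutually inverse relabellings
  \<open>P\<close> and \<open>Q\<close>. These preserve Lebesgue measure, and by
  \<open>det_reindex\<close> they preserve the Jacobian determinant.\<close>

proposition nn_integral_change_of_variables:
  fixes f :: "real^'n::finite \<Rightarrow> real" and g :: "real^'n::_ \<Rightarrow> real^'n::_"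
  assumes S: "S \<in> sets borel" and gS: "g ` S \<in> sets borel"
    and der: "\<And>x. x \<in> S \<Longrightarrow> (g has_derivative g' x) (at x within S)"
    and inj: "inj_on g S"
    and nonneg: "\<And>y. y \<in> g ` S \<Longrightarrow> 0 \<le> f y"
    and f: "set_borel_measurable borel (g ` S) f"
    and fg: "set_borel_measurable borel S (\<lambda>x. \<bar>det (matrix (g' x))\<bar> * f (g x))"
  shows "(\<integral>\<^sup>+y\<in>g ` S. ennreal (f y) \<partial>lborel) =
         (\<integral>\<^sup>+x\<in>S. ennreal (\<bar>det (matrix (g' x))\<bar> * f (g x)) \<partial>lborel)"
proof -
  obtain \<sigma> :: "'n ranked \<Rightarrow> 'n" where \<sigma>: "bij \<sigma>" using ranked_bij by blast
  define P where "P = (relabel \<sigma> :: real^'n \<Rightarrow> real^'n ranked)"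
  define Q where "Q = (relabel (inv \<sigma>) :: real^'n ranked \<Rightarrow> real^'n)"
  have QP [simp]: "Q (P x) = x" and PQ [simp]: "P (Q y) = y" for x y
    using relabel_inv[OF \<sigma>] by (auto simp: P_def Q_def)
  have [measurable]: "P \<in> borel_measurable borel" "Q \<in> borel_measurable borel"
    by (simp_all add: P_def Q_def)
  have P_bl: "bounded_linear P" and Q_bl: "bounded_linear Q"
    by (simp_all add: P_def Q_def bounded_linear_relabel)
  \<comment> \<open>Writing images under \<open>P\<close> as preimages under \<open>Q\<close>
    reduces their measurability to that of \<open>Q\<close>.\<close>
  have PS: "P ` A = Q -` A" for A by (auto simp: image_iff) (metis PQ)
  have Pborel: "P ` A \<in> sets borel" if "A \<in> sets borel" for A
    unfolding PS using measurable_sets_borel[of Q borel A] that by simp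
  have Qmem: "Q y \<in> A \<longleftrightarrow> y \<in> P ` A" for y A by (simp add: PS)
  have nnQ: "(\<integral>\<^sup>+x\<in>A. ennreal (h x) \<partial>lborel) = (\<integral>\<^sup>+y\<in>P ` A. ennreal (h (Q y)) \<partial>lborel)"
    if A: "A \<in> sets borel" and h: "set_borel_measurable borel A h" for A and h :: "real^'n \<Rightarrow> real"
  proof -
    \<comment> \<open>Only the restriction of \<open>h\<close> to \<open>A\<close> is known to be
      measurable, so the indicator is kept inside the integrand.\<close>
    have [measurable]: "(\<lambda>x. indicator A x * h x) \<in> borel_measurable borel"
      using h by (simp add: set_borel_measurable_def)
    have "(\<integral>\<^sup>+x\<in>A. ennreal (h x) \<partial>lborel) = (\<integral>\<^sup>+x. ennreal (indicator A x * h x) \<partial>lborel)"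
      by (rule nn_integral_cong) (auto simp: indicator_def)
    also have "\<dots> = (\<integral>\<^sup>+x. ennreal (indicator A x * h x) \<partial>distr lborel borel Q)"
      unfolding Q_def lborel_relabel[OF bij_imp_bij_inv[OF \<sigma>]] ..
    also have "\<dots> = (\<integral>\<^sup>+y. ennreal (indicator A (Q y) * h (Q y)) \<partial>lborel)"
      by (rule nn_integral_distr) simp_all
    also have "\<dots> = (\<integral>\<^sup>+y\<in>P ` A. ennreal (h (Q y)) \<partial>lborel)"
      by (rule nn_integral_cong) (auto simp: indicator_def PS)
    finally show ?thesis .
  qed
  have measQ: "set_borel_measurable borel (P ` A) (\<lambda>y. h (Q y))"
    if h: "set_borel_measurable borel A h" for A and h :: "real^'n \<Rightarrow> real"
  proof -
    have "(\<lambda>x. indicator A x *\<^sub>R h x) \<circ> Q \<in> borel_measurable borel"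
      by (rule measurable_comp[where N = borel]) (use h in \<open>simp_all add: set_borel_measurable_def\<close>)
    moreover have "(\<lambda>x. indicator A x *\<^sub>R h x) \<circ> Q = (\<lambda>y. indicator (P ` A) y *\<^sub>R h (Q y))"
      by (auto simp: fun_eq_iff indicator_def PS)
    ultimately show ?thesis by (simp add: set_borel_measurable_def)
  qed
  define G where "G = P \<circ> g \<circ> Q"
  define G' where "G' y = P \<circ> g' (Q y) \<circ> Q" for y
  have img: "G ` P ` A = P ` g ` A" for A by (auto simp: G_def image_image)
  have detG: "det (matrix (G' y)) = det (matrix (g' (Q y)))" for y
  proof -
    have "matrix (G' y) = (\<chi> i j. matrix (g' (Q y)) $ \<sigma> i $ \<sigma> j)"
    proof -
      have "Q (axis j 1) = axis (\<sigma> j) 1" for j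
      proof -
        have "inv \<sigma> i = j \<longleftrightarrow> i = \<sigma> j" for i
          using bij_inv_eq_iff[OF \<sigma>] by metis
        then show ?thesis by (simp add: Q_def vec_eq_iff axis_def)
      qed
      then show ?thesis by (simp add: matrix_def G'_def P_def relabel_def)
    qed
    then show ?thesis using det_reindex[OF \<sigma>] by metis
  qed
  have "(\<integral>\<^sup>+y\<in>g ` S. ennreal (f y) \<partial>lborel) = (\<integral>\<^sup>+y\<in>G ` P ` S. ennreal (f (Q y)) \<partial>lborel)"
    unfolding img by (rule nnQ[OF gS f])
  also have "\<dots> = (\<integral>\<^sup>+y\<in>P ` S. ennreal (\<bar>det (matrix (G' y))\<bar> * f (Q (G y))) \<partial>lborel)"
  proof (rule nn_integral_change_of_variables_wellorder)
    fix y assume "y \<in> P ` S"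
    then obtain x where x: "x \<in> S" "y = P x" by auto
    have "(g has_derivative g' x) (at x within Q ` (P ` S))"
      using der[OF x(1)] by (simp add: image_image)
    then have "(g \<circ> Q has_derivative g' x \<circ> Q) (at y within P ` S)"
      using x(2) bounded_linear_imp_has_derivative[OF Q_bl]
      by (intro diff_chain_within) auto
    then have "(P \<circ> (g \<circ> Q) has_derivative P \<circ> (g' x \<circ> Q)) (at y within P ` S)"
      by (rule diff_chain_within) (rule bounded_linear_imp_has_derivative[OF P_bl])
    then show "(G has_derivative G' y) (at y within P ` S)"
      using x(2) by (simp add: G_def G'_def comp_assoc)
  next
    show "inj_on G (P ` S)"
      using inj by (auto simp: inj_on_def G_def) (metis QP)
    show "set_borel_measurable borel (G ` P ` S) (\<lambda>y. f (Q y))"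
      unfolding img by (rule measQ[OF f])
    show "set_borel_measurable borel (P ` S) (\<lambda>y. \<bar>det (matrix (G' y))\<bar> * f (Q (G y)))"
      using measQ[OF fg] by (simp add: detG G_def)
  qed (use S gS Pborel nonneg in \<open>auto simp: img\<close>)
  also have "\<dots> = (\<integral>\<^sup>+x\<in>S. ennreal (\<bar>det (matrix (g' x))\<bar> * f (g x)) \<partial>lborel)"
    using nnQ[OF S fg] by (simp add: detG G_def)
  finally show ?thesis .
qed

section \<open>The canonical measure\<close>

text \<open>For existence, each piece of \<open>disjointed (\<lambda>n. U (c n))\<close> carries its own local measure.\<close>

lemma glue_measures:
  fixes M :: "'i \<Rightarrow> 'a measure" and U :: "'i \<Rightarrow> 'a set" and c :: "nat \<Rightarrow> 'i"
  assumes S: "\<And>i. i \<in> I \<Longrightarrow> sets (M i) = sets S" and space: "space S = UNIV"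
    and U: "\<And>i. i \<in> I \<Longrightarrow> U i \<in> sets S"
    and c: "range c \<subseteq> I" "(\<Union>n. U (c n)) = UNIV"
    and agree: "\<And>i j A. i \<in> I \<Longrightarrow> j \<in> I \<Longrightarrow> A \<in> sets S \<Longrightarrow> A \<subseteq> U i \<Longrightarrow> A \<subseteq> U j \<Longrightarrow>
      emeasure (M i) A = emeasure (M j) A"
  shows "\<exists>!\<nu>. sets \<nu> = sets S \<and> (\<forall>i\<in>I. \<forall>A\<in>sets S. A \<subseteq> U i \<longrightarrow> emeasure \<nu> A = emeasure (M i) A)"
proof -
  define D where "D = disjointed (\<lambda>n. U (c n))"
  have cI: "c n \<in> I" for n using c by auto
  have D: "range D \<subseteq> sets S" "disjoint_family D" "(\<Union>n. D n) = UNIV"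
    unfolding D_def
    by (auto intro!: sets.range_disjointed_sets simp: disjoint_family_disjointed UN_disjointed_eq c U cI)
  have D_sub: "D n \<subseteq> U (c n)" for n 
    using disjointed_subset[of "\<lambda>n. U (c n)" n] by (simp add: D_def)
  have D_sets: "D n \<in> sets S" for n using D by auto
  have disj: "disjoint_family (\<lambda>n. A \<inter> D n)" for A
    using D(2) by (auto simp: disjoint_family_on_def)
  have split: "(\<Union>n. A \<inter> D n) = A" for A using D(3) by auto
  have decomp: "emeasure \<nu> A = (\<Sum>n. emeasure \<nu> (A \<inter> D n))"
    if "sets \<nu> = sets S" "A \<in> sets S" for \<nu> A
  proof -
    have "range (\<lambda>n. A \<inter> D n) \<subseteq> sets \<nu>" using that D_sets by auto
    from suminf_emeasure[OF this disj] show ?thesis unfolding split by simp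
  qed
  \<comment> \<open>The sum over the pieces is written as an integral for counting measure, so that
    countable additivity becomes an exchange of this integral with a series.\<close>
  define F where "F A = (\<integral>\<^sup>+n. emeasure (M (c n)) (A \<inter> D n) \<partial>count_space UNIV)" for A
  define \<nu> where "\<nu> = measure_of UNIV (sets S) F"
  have sig: "sigma_sets UNIV (sets S) = sets S"
    using sets.sigma_sets_eq[of S] space by simp
  have sets_\<nu>: "sets \<nu> = sets S" by (simp add: \<nu>_def sig)
  have em: "emeasure \<nu> A = F A" if A: "A \<in> sets S" for A
  proof (rule emeasure_measure_of[OF \<nu>_def])
    show "positive (sets \<nu>) F" by (simp add: positive_def F_def)
    show "countably_additive (sets \<nu>) F"
    proof (rule countably_additiveI)
      fix B :: "nat \<Rightarrow> 'a set"
      assume B: "range B \<subseteq> sets \<nu>" "disjoint_family B"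
      have inner: "(\<Sum>i. emeasure (M (c n)) (B i \<inter> D n)) = emeasure (M (c n)) ((\<Union>i. B i) \<inter> D n)" for n
      proof -
        have "range (\<lambda>i. B i \<inter> D n) \<subseteq> sets (M (c n))" "disjoint_family (\<lambda>i. B i \<inter> D n)"
          using B D_sets S[OF cI] by (auto simp: sets_\<nu> disjoint_family_on_def)
        from suminf_emeasure[OF this] show ?thesis by simp
      qed
      have "(\<Sum>i. F (B i)) = (\<integral>\<^sup>+n. (\<Sum>i. emeasure (M (c n)) (B i \<inter> D n)) \<partial>count_space UNIV)"
        unfolding F_def by (rule nn_integral_suminf[symmetric]) simp
      then show "(\<Sum>i. F (B i)) = F (\<Union>i. B i)" by (simp only: inner F_def)
    qed
  qed (use A sets_\<nu> in auto)
  have loc: "emeasure \<nu> A = emeasure (M i) A" if i: "i \<in> I" and A: "A \<in> sets S" "A \<subseteq> U i" for i A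
  proof -
    have "emeasure \<nu> A = (\<Sum>n. emeasure (M (c n)) (A \<inter> D n))"
      by (simp add: em A F_def nn_integral_count_space_nat)
    also have "\<dots> = (\<Sum>n. emeasure (M i) (A \<inter> D n))"
      by (rule suminf_cong, rule agree) (use i cI A D_sub D_sets in auto)
    also have "\<dots> = emeasure (M i) A"
      using decomp S i A by simp
    finally show ?thesis .
  qed
  show ?thesis
  proof (rule ex1I[of _ \<nu>])
    fix \<mu> assume \<mu>: "sets \<mu> = sets S \<and> (\<forall>i\<in>I. \<forall>A\<in>sets S. A \<subseteq> U i \<longrightarrow> emeasure \<mu> A = emeasure (M i) A)"
    show "\<mu> = \<nu>"
    proof (rule measure_eqI)
      fix A assume "A \<in> sets \<mu>"
      then have A: "A \<in> sets S" using \<mu> by simp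
      \<comment> \<open>Uniqueness: each piece \<open>D n\<close> lies in a single
        \<open>U (c n)\<close>, where the local condition fixes the measure.\<close>
      have eq: "emeasure \<mu> (A \<inter> D n) = emeasure \<nu> (A \<inter> D n)" for n
      proof -
        have "A \<inter> D n \<in> sets S" "A \<inter> D n \<subseteq> U (c n)" using A D_sets D_sub by auto
        then show ?thesis using \<mu> loc[OF cI] cI by metis
      qed
      show "emeasure \<mu> A = emeasure \<nu> A"
        using decomp[OF _ A, of \<mu>] decomp[OF sets_\<nu> A] \<mu> eq by simp
    qed (simp add: \<mu> sets_\<nu>)
  qed (use sets_\<nu> loc in blast)
qed

section \<open>Charts, transition maps and the density of the induced metric\<close>

lemma smooth_onD:
  assumes "smooth_on S f" "x \<in> S"
  shows "(f has_derivative frechet_derivative f (at x)) (at x)"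
  using assms unfolding smooth_on_def
  by (metis Ck_on.simps(2) frechet_derivative_works)

lemma smooth_on_continuous_derivative:
  assumes "smooth_on S f"
  shows "continuous_on S (\<lambda>x. frechet_derivative f (at x) v)"
  using assms unfolding smooth_on_def by (metis Ck_on.simps)

lemma continuous_on_det:
  fixes A :: "'a::topological_space \<Rightarrow> real^'n::finite^'n"
  assumes "\<And>i j. continuous_on S (\<lambda>x. A x $ i $ j)"
  shows "continuous_on S (\<lambda>x. det (A x))"
  unfolding det_def by (intro continuous_intros assms)

locale immersed_manifold =
  fixes \<A> :: "('a::{t2_space,second_countable_topology}, 'n::finite) chart set"
    and \<psi> :: "'a \<Rightarrow> real ^ 'k::finite"
  assumes atlas: "smooth_atlas \<A>" and immersion: "smooth_immersion \<A> \<psi>"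
begin

abbreviation chart_image :: "('a, 'n) chart \<Rightarrow> (real^'n) set" where
  "chart_image c \<equiv> snd c ` fst c"

definition dX :: "('a, 'n) chart \<Rightarrow> real^'n \<Rightarrow> real^'n \<Rightarrow> real^'k" where
  "dX c x = frechet_derivative (\<psi> \<circ> chart_inv c) (at x)"

definition density_in :: "('a, 'n) chart \<Rightarrow> real^'n \<Rightarrow> real" where
  "density_in c x = sqrt (det (induced_metric c \<psi> x))"

lemma chart:
  assumes "c \<in> \<A>"
  shows "open (fst c)" "open (chart_image c)" "continuous_on (fst c) (snd c)"
    "continuous_on (chart_image c) (chart_inv c)"
  using assms atlas by (auto simp: smooth_atlas_def is_chart_def homeomorphism_def)

lemma chart_inv [simp]:
  assumes "c \<in> \<A>" "p \<in> fst c"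
  shows "chart_inv c (snd c p) = p"
  using assms atlas by (auto simp: smooth_atlas_def is_chart_def homeomorphism_def)

lemma inj_chart: "c \<in> \<A> \<Longrightarrow> inj_on (snd c) (fst c)"
  by (metis chart_inv inj_onI)

text \<open>Expressing an image as a preimage lets continuity of \<open>chart_inv c\<close> settle
  whether chart images are open or Borel.\<close>

lemma chart_image_vimage:
  assumes "c \<in> \<A>" "A \<subseteq> fst c"
  shows "snd c ` A = chart_inv c -` A \<inter> chart_image c"
  using assms by force

lemma chart_cover: "\<exists>c\<in>\<A>. p \<in> fst c"
  using atlas by (auto simp: smooth_atlas_def)

lemma open_chart_image:
  assumes "c \<in> \<A>" "A \<subseteq> fst c" "open A"
  shows "open (snd c ` A)"
  unfolding chart_image_vimage[OF assms(1,2)] Int_commute[of "chart_inv c -` A"]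
  by (rule continuous_open_preimage[OF chart(4,2)]) (use assms in auto)

lemma chart_image_borel:
  assumes "c \<in> \<A>" "A \<subseteq> fst c" "A \<in> sets borel"
  shows "snd c ` A \<in> sets borel"
proof -
  have "chart_inv c -` A \<inter> space (restrict_space borel (chart_image c)) \<in> sets (restrict_space borel (chart_image c))"
    by (rule measurable_sets[OF borel_measurable_continuous_on_restrict[OF chart(4)]]) (use assms in auto)
  then show ?thesis
    using chart(2)[OF assms(1)] unfolding chart_image_vimage[OF assms(1,2)]
    by (subst (asm) sets_restrict_space_iff) (auto simp: space_restrict_space)
qed

lemma dX_deriv:
  assumes "c \<in> \<A>" "x \<in> chart_image c"
  shows "((\<psi> \<circ> chart_inv c) has_derivative dX c x) (at x)"
  using assms immersion unfolding smooth_immersion_def dX_def by (blast intro: smooth_onD)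

lemma linear_dX: "c \<in> \<A> \<Longrightarrow> x \<in> chart_image c \<Longrightarrow> linear (dX c x)"
  using dX_deriv has_derivative_linear by blast

lemma inj_dX: "c \<in> \<A> \<Longrightarrow> x \<in> chart_image c \<Longrightarrow> inj (dX c x)"
  using immersion by (auto simp: smooth_immersion_def dX_def)

lemma continuous_on_dX: "c \<in> \<A> \<Longrightarrow> continuous_on (chart_image c) (\<lambda>x. dX c x v)"
  using immersion unfolding smooth_immersion_def dX_def
  by (blast intro: smooth_on_continuous_derivative)

lemma transition_deriv:
  fixes c d
  defines "\<phi> \<equiv> snd d \<circ> chart_inv c"
  assumes "c \<in> \<A>" "d \<in> \<A>" "x \<in> snd c ` (fst c \<inter> fst d)"
  shows "(\<phi> has_derivative frechet_derivative \<phi> (at x)) (at x)"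
    and "dX c x = dX d (\<phi> x) \<circ> frechet_derivative \<phi> (at x)"
proof -
  let ?O = "snd c ` (fst c \<inter> fst d)"
  show d\<phi>: "(\<phi> has_derivative frechet_derivative \<phi> (at x)) (at x)"
    using assms atlas unfolding smooth_atlas_def by (blast intro: smooth_onD)
  have \<phi>x: "\<phi> x \<in> chart_image d" using assms by auto
  have "(\<psi> \<circ> chart_inv d \<circ> \<phi> has_derivative dX d (\<phi> x) \<circ> frechet_derivative \<phi> (at x)) (at x)"
    by (rule diff_chain_at[OF d\<phi> dX_deriv]) (use assms \<phi>x in auto)
  \<comment> \<open>The factorisation of \<open>\<psi> \<circ> chart_inv c\<close> through \<phi> is
    available on \<open>?O\<close>; as this set is open, it is a neighbourhood of \<open>x\<close>
    and the derivatives agree there.\<close>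
  moreover have "open ?O"
    using assms by (intro open_chart_image open_Int chart(1)) auto
  ultimately have "(\<psi> \<circ> chart_inv c has_derivative dX d (\<phi> x) \<circ> frechet_derivative \<phi> (at x)) (at x)"
    by (rule has_derivative_transform_within_open) (use assms in \<open>auto simp: \<phi>_def\<close>)
  then show "dX c x = dX d (\<phi> x) \<circ> frechet_derivative \<phi> (at x)"
    using has_derivative_unique dX_deriv assms by blast
qed

lemma induced_metric_matrix:
  "induced_metric c \<psi> x = transpose (matrix (dX c x)) ** matrix (dX c x)"
  by (simp add: induced_metric_def Let_def dX_def[symmetric] vec_eq_iff matrix_matrix_mult_def
      transpose_def matrix_def inner_vec_def)

text \<open>By the chain rule the Gram matrix changes by congruence with the Jacobian matrix, so its
  determinant is multiplied by the square of the Jacobian determinant; the square root turns this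
  factor into an absolute value.\<close>

lemma density_transition:
  fixes c d
  defines "\<phi> \<equiv> snd d \<circ> chart_inv c"
  assumes "c \<in> \<A>" "d \<in> \<A>" "x \<in> snd c ` (fst c \<inter> fst d)"
  shows "density_in c x = \<bar>det (matrix (frechet_derivative \<phi> (at x)))\<bar> * density_in d (\<phi> x)"
proof -
  let ?J = "matrix (frechet_derivative \<phi> (at x))" and ?B = "matrix (dX d (\<phi> x))"
  note tr = transition_deriv[OF assms(2-4), folded \<phi>_def]
  have "\<phi> x \<in> chart_image d" using assms by auto
  then have "matrix (dX c x) = ?B ** ?J"
    unfolding tr(2) using tr(1) assms(3) by (intro matrix_compose linear_dX has_derivative_linear)
  then have "induced_metric c \<psi> x = transpose ?J ** induced_metric d \<psi> (\<phi> x) ** ?J"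
    by (simp add: induced_metric_matrix matrix_transpose_mul matrix_mul_assoc)
  then have "det (induced_metric c \<psi> x) = (det ?J)\<^sup>2 * det (induced_metric d \<psi> (\<phi> x))"
    by (simp add: det_mul det_transpose power2_eq_square)
  then show ?thesis
    by (simp add: density_in_def real_sqrt_mult)
qed

lemma continuous_on_density:
  assumes "c \<in> \<A>"
  shows "continuous_on (chart_image c) (density_in c)"
proof -
  have "continuous_on (chart_image c) (\<lambda>x. dX c x (axis i 1) \<bullet> dX c x (axis j 1))" for i j
    by (rule continuous_on_inner) (rule continuous_on_dX[OF assms])+
  then have "continuous_on (chart_image c) (\<lambda>x. det (induced_metric c \<psi> x))"
    by (intro continuous_on_det) (simp add: induced_metric_def Let_def dX_def)
  then show ?thesis unfolding density_in_def by (rule continuous_on_real_sqrt)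
qed

text \<open>Continuity of \<open>chart_inv c\<close> is known on the chart image, hence the
  restriction before the push-forward. The result is a Borel measure on the whole manifold, as
  \<open>glue_measures\<close> expects.\<close>

definition chart_measure :: "('a, 'n) chart \<Rightarrow> 'a measure" where
  "chart_measure c = distr (density (restrict_space lborel (chart_image c)) (\<lambda>x. ennreal (density_in c x)))
     borel (chart_inv c)"

lemma emeasure_chart_measure:
  assumes c: "c \<in> \<A>" and A: "A \<in> sets borel" "A \<subseteq> fst c"
  shows "emeasure (chart_measure c) A = (\<integral>\<^sup>+x\<in>snd c ` A. ennreal (density_in c x) \<partial>lborel)"
proof -
  let ?R = "restrict_space lborel (chart_image c)"
  have R: "sets ?R = sets (restrict_space borel (chart_image c))"
    by (rule sets_restrict_space_cong) simp
  have [measurable]: "density_in c \<in> borel_measurable ?R" "chart_inv c \<in> measurable ?R borel"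
    using borel_measurable_continuous_on_restrict[OF continuous_on_density[OF c]]
      borel_measurable_continuous_on_restrict[OF chart(4)[OF c]]
    by (simp_all add: measurable_cong_sets[OF R refl])
  have O: "chart_image c \<in> sets borel" using chart(2)[OF c] by simp
  have "emeasure (chart_measure c) A =
      (\<integral>\<^sup>+x\<in>chart_inv c -` A \<inter> space ?R. ennreal (density_in c x) \<partial>?R)"
    unfolding chart_measure_def using A(1)
    by (subst emeasure_distr) (auto simp: emeasure_density)
  also have "\<dots> = (\<integral>\<^sup>+x\<in>snd c ` A. ennreal (density_in c x) \<partial>?R)"
    using chart_image_vimage[OF c A(2)] by (simp add: space_restrict_space)
  also have "\<dots> = (\<integral>\<^sup>+x\<in>snd c ` A. ennreal (density_in c x) \<partial>lborel)"
    using O A(2) by (subst nn_integral_restrict_space) (auto 0 4 intro!: nn_integral_cong simp: indicator_def)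
  finally show ?thesis .
qed

text \<open>This is the change of variables along the transition map, with
  \<open>density_transition\<close> supplying the Jacobian factor.\<close>

lemma chart_measure_agree:
  assumes c: "c \<in> \<A>" "d \<in> \<A>" and A: "A \<in> sets borel" "A \<subseteq> fst c" "A \<subseteq> fst d"
  shows "emeasure (chart_measure c) A = emeasure (chart_measure d) A"
proof -
  define \<phi> where "\<phi> = snd d \<circ> chart_inv c"
  \<comment> \<open>The change of variables asks for a nonnegative function. Since
    \<open>ennreal\<close> sends negative numbers to 0, the truncation leaves both integrals
    unchanged.\<close>
  define f where "f e x = max 0 (density_in e x)" for e x
  let ?J = "\<lambda>x. \<bar>det (matrix (frechet_derivative \<phi> (at x)))\<bar>"
  have img: "\<phi> ` snd c ` A = snd d ` A"
    using A c by (force simp: \<phi>_def image_image)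
  have sub: "x \<in> snd c ` (fst c \<inter> fst d)" if "x \<in> snd c ` A" for x
    using that A by auto
  have tr: "f c x = ?J x * f d (\<phi> x)" if "x \<in> snd c ` A" for x
    using density_transition[OF c sub[OF that], folded \<phi>_def]
    by (simp add: f_def max_def mult_le_0_iff zero_le_mult_iff)
  have meas: "set_borel_measurable borel (snd e ` A) (f e)" if "e \<in> \<A>" "A \<subseteq> fst e" for e
    unfolding f_def
    unfolding set_borel_measurable_def
    by (intro borel_measurable_continuous_on_indicator continuous_intros chart_image_borel
        continuous_on_subset[OF continuous_on_density]) (use that A in auto)
  have "(\<integral>\<^sup>+y\<in>\<phi> ` snd c ` A. ennreal (f d y) \<partial>lborel) =
      (\<integral>\<^sup>+x\<in>snd c ` A. ennreal (?J x * f d (\<phi> x)) \<partial>lborel)"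
  proof (rule nn_integral_change_of_variables)
    show "inj_on \<phi> (snd c ` A)"
    proof (rule inj_onI, clarsimp simp: \<phi>_def)
      fix p q assume pq: "p \<in> A" "q \<in> A"
        and eq: "snd d (chart_inv c (snd c p)) = snd d (chart_inv c (snd c q))"
      then have "snd d p = snd d q" using A c by (auto simp: subset_iff)
      then show "snd c p = snd c q" using inj_onD[OF inj_chart[OF c(2)]] pq A by blast
    qed
    show "set_borel_measurable borel (snd c ` A) (\<lambda>x. ?J x * f d (\<phi> x))"
    proof -
      \<comment> \<open>On the set in question the transformed integrand is \<open>f c\<close>, so
        its measurability follows from continuity of the density in the chart
        \<open>c\<close>.\<close>
      have "(\<lambda>x. indicator (snd c ` A) x *\<^sub>R (?J x * f d (\<phi> x))) = (\<lambda>x. indicator (snd c ` A) x *\<^sub>R f c x)"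
        using tr by (auto simp: indicator_def fun_eq_iff)
      then show ?thesis using meas[OF c(1) A(2)] by (simp add: set_borel_measurable_def)
    qed
    show "(\<phi> has_derivative frechet_derivative \<phi> (at x)) (at x within snd c ` A)" if "x \<in> snd c ` A" for x
      using transition_deriv(1)[OF c sub[OF that]] has_derivative_at_withinI unfolding \<phi>_def by blast
    show "0 \<le> f d y" for y by (simp add: f_def)
  qed (use A c meas chart_image_borel in \<open>simp_all add: img\<close>)
  also have "\<dots> = (\<integral>\<^sup>+x\<in>snd c ` A. ennreal (f c x) \<partial>lborel)"
    using tr by (auto intro!: nn_integral_cong simp: indicator_def)
  finally show ?thesis
    by (simp add: emeasure_chart_measure c A img) (simp add: f_def ennreal_max_0)
qed

text \<open>Second countability gives the Lindelof property; the gluing of measures needs a sequence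
  of charts.\<close>

lemma countable_subatlas: "\<exists>c :: nat \<Rightarrow> _. range c \<subseteq> \<A> \<and> (\<Union>n. fst (c n)) = UNIV"
proof -
  have "\<And>S. S \<in> fst ` \<A> \<Longrightarrow> open S" using chart(1) by auto
  then obtain \<F> where \<F>: "\<F> \<subseteq> fst ` \<A>" "countable \<F>" "\<Union>\<F> = \<Union>(fst ` \<A>)"
    by (rule Lindelof)
  have cover: "\<Union>(fst ` \<A>) = UNIV" using chart_cover by auto
  obtain \<C> where \<C>: "countable \<C>" "\<C> \<subseteq> \<A>" "\<F> = fst ` \<C>"
    using \<F> by (metis countable_subset_image)
  \<comment> \<open>The enumeration \<open>from_nat_into\<close> has the intended range for nonempty
    sets; here the domains cover a type, which is inhabited.\<close>
  have "\<C> \<noteq> {}" using \<C> \<F> cover by auto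
  then have range: "range (from_nat_into \<C>) = \<C>" by (simp add: \<C>(1) range_from_nat_into)
  have "(\<Union>n. fst (from_nat_into \<C> n)) = \<Union>(fst ` range (from_nat_into \<C>))"
    by blast
  also have "\<dots> = UNIV" using range \<C>(3) \<F>(3) cover by simp
  finally have "(\<Union>n. fst (from_nat_into \<C> n)) = UNIV" .
  moreover have "range (from_nat_into \<C>) \<subseteq> \<A>" using range \<C>(2) by simp
  ultimately show ?thesis by blast
qed

text \<open>The definite description in \<open>canonical_measure\<close> yields its properties once
  \<open>glue_measures\<close> has shown that exactly one such measure exists.\<close>

lemma sets_canonical_measure: "sets (canonical_measure \<A> \<psi>) = sets borel"
proof -
  obtain c :: "nat \<Rightarrow> _" where c: "range c \<subseteq> \<A>" "(\<Union>n. fst (c n)) = UNIV"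
    using countable_subatlas by blast
  have ex1: "\<exists>!\<nu>. sets \<nu> = sets borel \<and>
      (\<forall>c\<in>\<A>. \<forall>A\<in>sets borel. A \<subseteq> fst c \<longrightarrow> emeasure \<nu> A = emeasure (chart_measure c) A)"
  proof (rule glue_measures[where c = c and M = chart_measure and U = fst])
    show "fst d \<in> sets borel" if "d \<in> \<A>" for d
      using chart(1)[OF that] by (rule borel_open)
    show "sets (chart_measure d) = sets borel" for d
      by (simp add: chart_measure_def)
  qed (use c in \<open>auto intro: chart_measure_agree\<close>)
  have "canonical_measure \<A> \<psi> = (THE \<nu>. sets \<nu> = sets borel \<and>
      (\<forall>c\<in>\<A>. \<forall>A\<in>sets borel. A \<subseteq> fst c \<longrightarrow> emeasure \<nu> A = emeasure (chart_measure c) A))"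
    unfolding canonical_measure_def
    by (intro arg_cong[where f = The] ext conj_cong refl ball_cong imp_cong)
      (simp add: emeasure_chart_measure density_in_def)
  then show ?thesis using theI'[OF ex1] by simp
qed

end

section \<open>Tangential parts\<close>

lemma orth_proj_eqI:
  assumes T: "subspace T" and w: "w \<in> T" "\<And>u. u \<in> T \<Longrightarrow> (v - w) \<bullet> u = 0"
  shows "orth_proj T v = w"
  unfolding orth_proj_def
proof (rule the_equality)
  fix w' assume w': "w' \<in> T \<and> (\<forall>u\<in>T. (v - w') \<bullet> u = 0)"
  \<comment> \<open>The difference of two candidates lies in \<open>T\<close> and is orthogonal to
    \<open>T\<close>, hence to itself.\<close>
  have d: "w' - w \<in> T" using w(1) w' T by (simp add: subspace_diff)
  have "(w' - w) \<bullet> (w' - w) = (v - w) \<bullet> (w' - w) - (v - w') \<bullet> (w' - w)"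
    by (simp add: inner_diff_left)
  also have "\<dots> = 0" using w(2)[OF d] w' d by simp
  finally show "w' = w" by simp
qed (use w in blast)

lemma orth_proj_sum:
  fixes B :: "'b::euclidean_space set"
  assumes B: "pairwise orthogonal B" "\<And>b. b \<in> B \<Longrightarrow> norm b = 1" "finite B" "span B = T"
  shows "orth_proj T v = (\<Sum>b\<in>B. (v \<bullet> b) *\<^sub>R b)"
proof (rule orth_proj_eqI)
  show "subspace T" using B(4) by (metis subspace_span)
  show "(\<Sum>b\<in>B. (v \<bullet> b) *\<^sub>R b) \<in> T"
    unfolding B(4)[symmetric] by (intro span_sum span_scale span_base)
  have zero: "orthogonal (v - (\<Sum>b\<in>B. (v \<bullet> b) *\<^sub>R b)) y" if y: "y \<in> B" for y
  proof -
    have "(\<Sum>b\<in>B. (v \<bullet> b) *\<^sub>R b) \<bullet> y = (\<Sum>b\<in>B. if b = y then v \<bullet> y else 0)"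
      unfolding inner_sum_left
      by (rule sum.cong) (use B(1,2) y in \<open>auto simp: pairwise_def orthogonal_def norm_eq_1\<close>)
    then show ?thesis using y B(3) by (simp add: orthogonal_def inner_diff_left)
  qed
  show "(v - (\<Sum>b\<in>B. (v \<bullet> b) *\<^sub>R b)) \<bullet> u = 0" if "u \<in> T" for u
    using orthogonal_to_span[of u B] zero that B(4) by (auto simp: orthogonal_def)
qed

lemma sum_inner_Basis_squared:
  fixes x :: "'b::euclidean_space"
  shows "(\<Sum>e\<in>Basis. (x \<bullet> e)\<^sup>2) = (norm x)\<^sup>2"
  unfolding power2_norm_eq_inner using euclidean_inner[of x x] by (simp add: power2_eq_square)

context
  fixes T :: "'b::euclidean_space set"
  assumes T: "subspace T"
begin

lemma orthonormal_basis_orth_proj: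
  "\<exists>B. finite B \<and> card B = dim T \<and> (\<forall>b\<in>B. norm b = 1) \<and>
     (\<forall>v. (norm (orth_proj T v))\<^sup>2 = (\<Sum>b\<in>B. (v \<bullet> b)\<^sup>2))"
proof -
  obtain B where B: "pairwise orthogonal B" "\<And>b. b \<in> B \<Longrightarrow> norm b = 1"
      "independent B" "card B = dim T" "span B = T"
    using orthonormal_basis_subspace[OF T] by metis
  have fin: "finite B" using B(3) independent_imp_finite by blast
  note P = orth_proj_sum[OF B(1,2) fin B(5)]
  have "(norm (orth_proj T v))\<^sup>2 = (\<Sum>b\<in>B. (v \<bullet> b)\<^sup>2)" for v
  proof -
    have "(norm (\<Sum>b\<in>B. (v \<bullet> b) *\<^sub>R b))\<^sup>2 = (\<Sum>b\<in>B. (norm ((v \<bullet> b) *\<^sub>R b))\<^sup>2)"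
      by (rule norm_sum_Pythagorean[OF fin])
        (use B(1) in \<open>auto simp: pairwise_def orthogonal_def\<close>)
    also have "\<dots> = (\<Sum>b\<in>B. (v \<bullet> b)\<^sup>2)"
      by (rule sum.cong) (auto simp: B(2))
    finally show ?thesis by (simp add: P)
  qed
  with fin B show ?thesis by blast
qed

lemma orth_proj_in: "orth_proj T v \<in> T"
  and orth_proj_inner: "u \<in> T \<Longrightarrow> v \<bullet> u = orth_proj T v \<bullet> u"
proof -
  obtain B where B: "pairwise orthogonal B" "\<And>b. b \<in> B \<Longrightarrow> norm b = 1"
      "independent B" "span B = T"
    using orthonormal_basis_subspace[OF T] by metis
  obtain y z where yz: "y \<in> T" "\<And>w. w \<in> T \<Longrightarrow> orthogonal z w" "v = y + z"
    using orthogonal_subspace_decomp_exists[of T v] T by (metis span_eq_iff)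
  have "orth_proj T v = y"
    by (rule orth_proj_eqI[OF T]) (use yz in \<open>auto simp: orthogonal_def\<close>)
  then show "orth_proj T v \<in> T" "u \<in> T \<Longrightarrow> v \<bullet> u = orth_proj T v \<bullet> u"
    using yz by (auto simp: orthogonal_def inner_add_left)
qed

text \<open>Completing the square: for \<open>u\<close> in \<open>T\<close> the right-hand
  expression is the squared norm of the projection minus that of its difference from
  \<open>u\<close>, so its maximum is attained when \<open>u\<close> is the projection. The
  projection itself is absent from the right-hand side.\<close>

lemma norm_orth_proj_greater_iff:
  "t < (norm (orth_proj T v))\<^sup>2 \<longleftrightarrow> (\<exists>u\<in>T. t < 2 * (v \<bullet> u) - (norm u)\<^sup>2)"
proof
  assume "t < (norm (orth_proj T v))\<^sup>2"
  then show "\<exists>u\<in>T. t < 2 * (v \<bullet> u) - (norm u)\<^sup>2"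
    using orth_proj_in[of v] orth_proj_inner[OF orth_proj_in, of v v]
    by (intro bexI[of _ "orth_proj T v"]) (auto simp: power2_norm_eq_inner)
next
  assume "\<exists>u\<in>T. t < 2 * (v \<bullet> u) - (norm u)\<^sup>2"
  then obtain u where u: "u \<in> T" "t < 2 * (v \<bullet> u) - (norm u)\<^sup>2" by blast
  have "0 \<le> (norm (orth_proj T v - u))\<^sup>2" by simp
  also have "\<dots> = (norm (orth_proj T v))\<^sup>2 - (2 * (v \<bullet> u) - (norm u)\<^sup>2)"
    using orth_proj_inner[OF u(1), of v] inner_commute[of u "orth_proj T v"]
    by (simp add: power2_norm_eq_inner inner_diff)
  finally show "t < (norm (orth_proj T v))\<^sup>2" using u(2) by linarith
qed

lemma norm_orth_proj_le: "norm (orth_proj T v) \<le> norm v"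
proof -
  have "(norm (orth_proj T v))\<^sup>2 = v \<bullet> orth_proj T v"
    using orth_proj_inner[OF orth_proj_in, of v v] by (simp add: power2_norm_eq_inner)
  also have "\<dots> \<le> norm v * norm (orth_proj T v)" by (rule norm_cauchy_schwarz)
  finally show ?thesis
    by (cases "norm (orth_proj T v) = 0") (simp_all add: power2_eq_square)
qed

text \<open>This is the trace of the projection: after exchanging the sums, each vector of an
  orthonormal basis of \<open>T\<close> contributes its squared norm 1.\<close>

lemma sum_norm_orth_proj: "(\<Sum>e\<in>Basis. (norm (orth_proj T e))\<^sup>2) = real (dim T)"
proof -
  obtain B where B: "finite B" "card B = dim T" "\<And>b. b \<in> B \<Longrightarrow> norm b = 1"
      "\<And>v. (norm (orth_proj T v))\<^sup>2 = (\<Sum>b\<in>B. (v \<bullet> b)\<^sup>2)"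
    using orthonormal_basis_orth_proj by auto
  have "(\<Sum>e\<in>Basis. (norm (orth_proj T e))\<^sup>2) = (\<Sum>b\<in>B. \<Sum>e\<in>Basis. (b \<bullet> e)\<^sup>2)"
    unfolding B(4) by (subst sum.swap) (simp only: inner_commute)
  also have "\<dots> = (\<Sum>b\<in>B. (norm b)\<^sup>2)"
    by (simp only: sum_inner_Basis_squared)
  finally show ?thesis using B by simp
qed

end

section \<open>Tangent spaces of the immersion\<close>

context immersed_manifold
begin

lemma range_dX_subset:
  assumes "c \<in> \<A>" "d \<in> \<A>" "p \<in> fst c" "p \<in> fst d"
  shows "range (dX c (snd c p)) \<subseteq> range (dX d (snd d p))"
  using transition_deriv(2)[OF assms(1,2), of "snd c p"] assms by auto

text \<open>The chain rule gives inclusions both ways between the ranges in two charts. The tangent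
  space is thereby freed from the choice in \<open>chart_at\<close>, and one chart serves all points
  of its domain.\<close>

lemma tangent_space_eq:
  assumes "c \<in> \<A>" "p \<in> fst c"
  shows "tangent_space \<A> \<psi> p = range (dX c (snd c p))"
proof -
  have "chart_at \<A> p \<in> \<A> \<and> p \<in> fst (chart_at \<A> p)"
    unfolding chart_at_def by (rule someI[of _ c]) (use assms in simp)
  then show ?thesis
    unfolding tangent_space_def Let_def dX_def[symmetric]
    using range_dX_subset assms by blast
qed

lemma subspace_tangent_space: "subspace (tangent_space \<A> \<psi> p)"
  and dim_tangent_space: "dim (tangent_space \<A> \<psi> p) = CARD('n)"
proof -
  obtain c where c: "c \<in> \<A>" "p \<in> fst c" using chart_cover by blast
  then have lin: "linear (dX c (snd c p))" and inj: "inj (dX c (snd c p))"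
    using linear_dX inj_dX by auto
  show "subspace (tangent_space \<A> \<psi> p)"
    unfolding tangent_space_eq[OF c] by (rule linear_subspace_image[OF lin subspace_UNIV])
  show "dim (tangent_space \<A> \<psi> p) = CARD('n)"
    unfolding tangent_space_eq[OF c] using dim_image_eq[OF lin, of UNIV] inj by simp
qed

text \<open>The supremum formula \<open>norm_orth_proj_greater_iff\<close> makes \<open>\<parallel>v\<^sup>\<top>\<parallel>\<^sup>2\<close> a supremum of functions
  that are continuous in a chart, hence lower semicontinuous.\<close>

lemma open_tangential_part_greater: "open {p. t < (norm (tangential_part \<A> \<psi> v p))\<^sup>2}"
proof -
  define F where "F c u p = 2 * (v \<bullet> dX c (snd c p) u) - (norm (dX c (snd c p) u))\<^sup>2" for c u p
  have iff: "t < (norm (tangential_part \<A> \<psi> v p))\<^sup>2 \<longleftrightarrow> (\<exists>u. t < F c u p)"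
    if "c \<in> \<A>" "p \<in> fst c" for c p
    unfolding tangential_part_def norm_orth_proj_greater_iff[OF subspace_tangent_space]
    by (simp add: tangent_space_eq[OF that] F_def)
  \<comment> \<open>In a chart the competitors in \<open>T\<close> are the vectors
    \<open>dX c (snd c p) u\<close> with \<open>u\<close> independent of \<open>p\<close>, which
    makes each \<open>F c u\<close> continuous on the chart domain.\<close>
  have "{p. t < (norm (tangential_part \<A> \<psi> v p))\<^sup>2} = (\<Union>c\<in>\<A>. \<Union>u. fst c \<inter> F c u -` {t<..})"
    (is "?L = ?R")
  proof (rule set_eqI)
    fix p
    obtain c where "c \<in> \<A>" "p \<in> fst c" using chart_cover by blast
    then have "p \<in> ?R" if "p \<in> ?L" using iff that by fastforce
    moreover have "p \<in> ?L" if "p \<in> ?R"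
    proof -
      from that obtain d u where "d \<in> \<A>" "p \<in> fst d" "t < F d u p" by auto
      then show ?thesis using iff by blast
    qed
    ultimately show "p \<in> ?L \<longleftrightarrow> p \<in> ?R" by (rule iffI)
  qed
  moreover have "open (fst c \<inter> F c u -` {t<..})" if c: "c \<in> \<A>" for c u
  proof (rule continuous_open_preimage)
    have "continuous_on (fst c) (\<lambda>p. dX c (snd c p) u)"
      by (rule continuous_on_compose2[OF continuous_on_dX chart(3)]) (use c in auto)
    then show "continuous_on (fst c) (F c u)"
      unfolding F_def by (intro continuous_intros)
  qed (use chart(1)[OF c] in auto)
  ultimately show ?thesis by (simp only:) (intro open_UN ballI)
qed

lemma measurable_tangential_part:
  "(\<lambda>p. (norm (tangential_part \<A> \<psi> v p))\<^sup>2) \<in> borel_measurable (canonical_measure \<A> \<psi>)"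
  unfolding borel_measurable_iff_greater
  using open_tangential_part_greater sets_eq_imp_space_eq[OF sets_canonical_measure]
  by (simp add: sets_canonical_measure)

end

section \<open>Averaging\<close>

text \<open>If every quotient exceeded \<open>A / V\<close>, multiplying by the denominators and
  summing would give \<open>s * A < s * A\<close>.\<close>

lemma exists_quotient_le:
  fixes A V s :: real
  assumes E: "finite E" and A: "0 \<le> A" and V: "0 \<le> V" and s: "0 < s"
    and D: "\<And>e. e \<in> E \<Longrightarrow> 0 \<le> D e"
    and sums: "(\<Sum>e\<in>E. N e) = s * A" "(\<Sum>e\<in>E. D e) = s * V" and "E \<noteq> {}"
  shows "\<exists>e\<in>E. N e / D e \<le> A / V"
proof (rule ccontr)
  assume "\<not> ?thesis"
  then have less: "A / V < N e / D e" if "e \<in> E" for e using that by auto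
  \<comment> \<open>A zero denominator would make the quotient 0, which cannot exceed the
    nonnegative \<open>A / V\<close>.\<close>
  have pos: "0 < D e" if "e \<in> E" for e
    using less[OF that] D[OF that] divide_nonneg_nonneg[OF A V] by (cases "D e = 0") auto
  then have "0 < s * V" unfolding sums(2)[symmetric] using E \<open>E \<noteq> {}\<close> by (simp add: sum_pos)
  then have "V \<noteq> 0" by auto
  have "(\<Sum>e\<in>E. A / V * D e) < (\<Sum>e\<in>E. N e)"
    using less pos by (intro sum_strict_mono E \<open>E \<noteq> {}\<close>) (simp add: pos_less_divide_eq)
  then show False
    using \<open>V \<noteq> 0\<close> unfolding sum_distrib_left[symmetric] sums by simp
qed

context immersed_manifold
begin

abbreviation "\<mu> \<equiv> canonical_measure \<A> \<psi>"
abbreviation "H \<equiv> mean_curvature \<A> \<psi>"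

text \<open>The Bochner integral of a non-integrable function is \<open>0\<close>, so whenever an integral that enters
  the averaging fails to exist, some quotient on the left vanishes. The same holds if \<open>\<mu>\<close> is infinite, where \<open>volume\<close> is \<open>0\<close> and \<open>x / 0 = 0\<close>.\<close>

lemma averaging:
  fixes \<epsilon> :: real
  assumes \<epsilon>: "\<epsilon> = 1 \<or> \<epsilon> = -1" and k: "2 \<le> CARD('k)"
  shows "\<exists>e\<in>Basis. (\<integral>p. (norm (H p))\<^sup>2 + \<epsilon> * (H p \<bullet> e)\<^sup>2 \<partial>\<mu>) /
      (volume \<A> \<psi> + \<epsilon> * (1 / real CARD('n) * (\<integral>p. (norm (tangential_part \<A> \<psi> e p))\<^sup>2 \<partial>\<mu>)))
    \<le> (\<integral>p. (norm (H p))\<^sup>2 \<partial>\<mu>) / volume \<A> \<psi>"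
    (is "\<exists>e\<in>Basis. ?N e / ?D e \<le> ?A / ?V")
proof -
  let ?n = "real CARD('n)" and ?a = "\<lambda>e p. (norm (tangential_part \<A> \<psi> e p))\<^sup>2"
  have space: "space \<mu> = UNIV"
    using sets_eq_imp_space_eq[OF sets_canonical_measure] by simp
  have A: "0 \<le> ?A" by simp
  have V: "0 \<le> ?V" by (simp add: volume_def)
  have H_sum: "(\<Sum>e\<in>Basis. (H p \<bullet> e)\<^sup>2) = (norm (H p))\<^sup>2" for p
    by (rule sum_inner_Basis_squared)
  have a_sum: "(\<Sum>e\<in>Basis. ?a e p) = ?n" for p
    using sum_norm_orth_proj[OF subspace_tangent_space]
    by (simp add: tangential_part_def dim_tangent_space)
  \<comment> \<open>In these cases the left quotient is 0, by \<open>x / 0 = 0\<close> if the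
    denominator vanishes, and the right one is nonnegative.\<close>
  have zero: ?thesis if "e \<in> Basis" "?N e = 0 \<or> ?D e = 0" for e
    using that A V by (intro bexI[of _ e]) auto
  show ?thesis
  proof (cases "emeasure \<mu> UNIV = \<infinity>")
    case True
    \<comment> \<open>The functions \<open>?a e\<close> add up to the constant \<open>?n\<close>,
      which has no integral for an infinite measure, so one of them is not integrable.\<close>
    have "\<not> integrable \<mu> (\<lambda>p. ?n)"
      using True by (simp add: space integrable_iff_bounded ennreal_mult_eq_top_iff)
    then have "\<not> integrable \<mu> (\<lambda>p. \<Sum>e\<in>Basis. ?a e p)" by (simp add: a_sum)
    then have "\<not> (\<forall>e\<in>Basis. integrable \<mu> (?a e))"
      by (rule contrapos_nn) (rule Bochner_Integration.integrable_sum, erule bspec)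
    then obtain e where e: "e \<in> Basis" "\<not> integrable \<mu> (?a e)"
      by auto
    have "?V = 0" using True by (simp add: volume_def measure_def)
    then have "?D e = 0" by (simp add: not_integrable_integral_eq[OF e(2)])
    then show ?thesis using zero[OF e(1)] by blast
  next
    case False
    then interpret finite_measure \<mu> by (intro finite_measureI) (simp add: space)
    have a_le: "?a e p \<le> 1" if "e \<in> Basis" for e p
      using norm_orth_proj_le[OF subspace_tangent_space, of p e] that
      by (simp add: tangential_part_def power_le_one)
    have a_int: "integrable \<mu> (?a e)" if "e \<in> Basis" for e
      by (rule integrable_const_bound[where B = 1])
        (use a_le[OF that] measurable_tangential_part in auto)
    have a_int_le: "(\<integral>p. ?a e p \<partial>\<mu>) \<le> ?V" if "e \<in> Basis" for e
    proof -
      have "(\<integral>p. ?a e p \<partial>\<mu>) \<le> (\<integral>p. 1 \<partial>\<mu>)"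
        by (rule integral_mono) (use a_int a_le that in auto)
      then show ?thesis by (simp add: volume_def space)
    qed
    have "(\<Sum>e\<in>Basis. (\<integral>p. ?a e p \<partial>\<mu>)) = (\<integral>p. (\<Sum>e\<in>Basis. ?a e p) \<partial>\<mu>)"
      by (rule Bochner_Integration.integral_sum[symmetric]) (rule a_int)
    then have a_int_sum: "(\<Sum>e\<in>Basis. (\<integral>p. ?a e p \<partial>\<mu>)) = ?n * ?V"
      by (simp add: a_sum space volume_def)
    \<comment> \<open>The bounds \<open>?a e p \<le> 1\<close> and \<open>1 / ?n \<le> 1\<close>
      keep the subtracted term below the volume when \<epsilon> is -1.\<close>
    have D: "0 \<le> ?D e" if "e \<in> Basis" for e
    proof -
      have "1 / ?n * (\<integral>p. ?a e p \<partial>\<mu>) \<le> 1 * ?V"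
        using a_int_le[OF that] by (intro mult_mono) (auto simp: Suc_leI)
      moreover have "0 \<le> 1 / ?n * (\<integral>p. ?a e p \<partial>\<mu>)" by simp
      ultimately show ?thesis using \<epsilon> V by auto
    qed
    let ?K = "real CARD('k)" and ?h = "\<lambda>e p. (norm (H p))\<^sup>2 + \<epsilon> * (H p \<bullet> e)\<^sup>2"
    \<comment> \<open>The common factor of both sums is \<open>?K + \<epsilon>\<close>: the
      \<open>?K\<close> basis vectors each contribute the fixed term once, and the varying terms add
      \<epsilon> times it. For \<epsilon> = -1, positivity comes from
      \<open>2 \<le> CARD('k)\<close>.\<close>
    have s: "0 < ?K + \<epsilon>" using \<epsilon> k by auto
    have h_sum: "(\<Sum>e\<in>Basis. ?h e p) = (?K + \<epsilon>) * (norm (H p))\<^sup>2" for p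
    proof -
      have "(\<Sum>e\<in>Basis. ?h e p) = ?K * (norm (H p))\<^sup>2 + \<epsilon> * (\<Sum>e\<in>Basis. (H p \<bullet> e)\<^sup>2)"
        by (simp add: sum.distrib sum_distrib_left)
      then show ?thesis by (simp add: H_sum distrib_right)
    qed
    \<comment> \<open>Nothing is known here about the regularity of \<open>H\<close>, so
      integrability of the numerators is decided by cases.\<close>
    show ?thesis
    proof (cases "\<forall>e\<in>Basis. integrable \<mu> (?h e)")
      case False
      then obtain e where e: "e \<in> Basis" "\<not> integrable \<mu> (?h e)" by auto
      show ?thesis
        using zero[OF e(1)] not_integrable_integral_eq[OF e(2)] by blast
    next
      case True
      then have "(\<Sum>e\<in>Basis. ?N e) = (\<integral>p. (\<Sum>e\<in>Basis. ?h e p) \<partial>\<mu>)"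
        by (intro Bochner_Integration.integral_sum[symmetric]) blast
      then have "(\<Sum>e\<in>Basis. ?N e) = (?K + \<epsilon>) * ?A" by (simp add: h_sum)
      moreover have "(\<Sum>e\<in>Basis. ?D e) = (?K + \<epsilon>) * ?V"
      proof -
        have "(\<Sum>e\<in>Basis. ?D e) = ?K * ?V + \<epsilon> * (1 / ?n * (\<Sum>e\<in>Basis. (\<integral>p. ?a e p \<partial>\<mu>)))"
          by (simp add: sum.distrib sum_distrib_left)
        then show ?thesis by (simp add: a_int_sum distrib_right)
      qed
      ultimately show ?thesis
        by (intro exists_quotient_le[OF finite_Basis A V s D] nonempty_Basis)
    qed
  qed
qed

end

theorem theoremC:
  fixes n m :: nat
    and \<A> :: "('a::{t2_space,second_countable_topology}, 'n::finite) chart set"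
    and \<psi> :: "'a \<Rightarrow> real ^ 'k::finite"
  assumes "CARD('n) = n" and "CARD('k) = m + 1"
    and "n \<ge> 2" and "n \<le> m"
    and "smooth_atlas \<A>"
    and "compact (UNIV :: 'a set)" and "connected (UNIV :: 'a set)"
    and "smooth_immersion \<A> \<psi>"
  shows "(\<exists>v. v \<noteq> 0 \<and> b_quot \<A> \<psi> v \<le> B_quot \<A> \<psi>) \<and>
         (\<exists>v\<in>sphere 0 1. b_tilde_quot \<A> \<psi> v \<le> B_quot \<A> \<psi>)"
proof -
  interpret immersed_manifold \<A> \<psi>
    using assms by unfold_locales
  have k: "2 \<le> CARD('k)" using assms by simp
  have pos: "0 \<le> real CARD('n)" by simp
  obtain v where v: "v \<in> Basis" "b_quot \<A> \<psi> v \<le> B_quot \<A> \<psi>"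
    using averaging[of 1, OF _ k] unfolding b_quot_def B_quot_def
    by (simp only: mult_1 simp_thms) (blast intro: mult_left_mono[OF _ pos])
  obtain w where w: "w \<in> Basis" "b_tilde_quot \<A> \<psi> w \<le> B_quot \<A> \<psi>"
    using averaging[of "-1", OF _ k] unfolding b_tilde_quot_def B_quot_def
    by (simp only: mult_minus1 simp_thms diff_conv_add_uminus) (blast intro: mult_left_mono[OF _ pos])
  \<comment> \<open>Basis vectors are nonzero and of norm 1, so they serve as witnesses for both
    claims.\<close>
  show ?thesis
    using v w nonzero_Basis by (auto intro!: exI[of _ v] bexI[of _ w])
qed

end
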